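(* Let $f=h+\overline{g}\in\mathcal{H}$, where $h(z)=z+\sum_{n=2}^{\infty}a_nz^n$ and $g(z)=\sum_{n=1}^{\infty}b_nz^n$ are analytic in $\mathbb{D}$, and let $\alpha\in\mathbb{C}$. Assume that $$g'(z)=\alpha z h'(z)\quad (z\in\mathbb{D})\qquad\text{and}\qquad \sum_{n=2}^{\infty}n^3|a_n|\le 1.$$ If $|\alpha|\le 2/11$, then $f$ is fully starlike of order $\dfrac{2(6-11|\alpha|)}{18+11|\alpha|}$ and, moreover, $f$ is fully convex of order $\dfrac{2(2-11|\alpha|)}{10+11|\alpha|}$.
   Context: $\mathbb{D}=\{z\in\mathbb{C}:|z|<1\}$. $\mathcal{H}$ is the class of complex-valued harmonic functions $f$ in $\mathbb{D}$ with $f(0)=0$ and $f_z(0)=1$. For $0\le\beta<1$, $f\in\mathcal{H}$ is fully starlike of order $\beta$ if $f$ is univalent and sense-preserving in $\mathbb{D}$, maps $\mathbb{D}$ onto a domain starlike with respect to the origin, and satisfies $\frac{\partial}{\partial\theta}\arg f(re^{i\theta})>\beta$ for all $0\le\theta<2\pi$, $0<r<1$. It is fully convex of order $\beta$ if $f$ is univalent and sense-preserving in $\mathbb{D}$, maps $\mathbb{D}$ onto a convex domain, and satisfies $\frac{\partial}{\partial\theta}\left(\arg\left\{\frac{\partial}{\partial\theta}f(re^{i\theta})\right\}\right)>\beta$ for all $0\le\theta<2\pi$, $0<r<1$. *)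

theory Defs
  imports "HOL-Complex_Analysis.Complex_Analysis"
begin

text \<open>Harmonic: twice continuously differentiable with vanishing Laplacian. The witnesses
  \<open>fx\<close>, \<open>fy\<close> are the first-order and \<open>fxx\<close>, \<open>fxy\<close>, \<open>fyx\<close>, \<open>fyy\<close> the second-order partial
  derivatives with respect to \<open>x = Re z\<close> and \<open>y = Im z\<close>.\<close>

definition harmonic_on :: "(complex \<Rightarrow> complex) \<Rightarrow> complex set \<Rightarrow> bool" where
  "harmonic_on f S \<longleftrightarrow> open S \<and>
    (\<exists>fx fy fxx fxy fyx fyy.
       continuous_on S fxx \<and> continuous_on S fxy \<and> continuous_on S fyx \<and> continuous_on S fyy \<and>
       (\<forall>z\<in>S. (f has_derivative (\<lambda>w. of_real (Re w) * fx z + of_real (Im w) * fy z)) (at z) \<and>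
              (fx has_derivative (\<lambda>w. of_real (Re w) * fxx z + of_real (Im w) * fxy z)) (at z) \<and>
              (fy has_derivative (\<lambda>w. of_real (Re w) * fyx z + of_real (Im w) * fyy z)) (at z) \<and>
              fxx z + fyy z = 0))"

text \<open>The Wirtinger derivatives \<open>(f\<^sub>x - \<i> f\<^sub>y) / 2\<close> and \<open>(f\<^sub>x + \<i> f\<^sub>y) / 2\<close>.\<close>

definition wirtinger :: "(complex \<Rightarrow> complex) \<Rightarrow> complex \<Rightarrow> complex" where
  "wirtinger f z = (frechet_derivative f (at z) 1 - \<i> * frechet_derivative f (at z) \<i>) / 2"

definition wirtinger_bar :: "(complex \<Rightarrow> complex) \<Rightarrow> complex \<Rightarrow> complex" where
  "wirtinger_bar f z = (frechet_derivative f (at z) 1 + \<i> * frechet_derivative f (at z) \<i>) / 2"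

definition class_H :: "(complex \<Rightarrow> complex) set" where
  "class_H = {f. harmonic_on f (ball 0 1) \<and> f 0 = 0 \<and> wirtinger f 0 = 1}"

text \<open>Positivity of the Jacobian determinant, which equals \<open>|f\<^sub>z|\<^sup>2 - |f\<^bsub>z-bar\<^esub>|\<^sup>2\<close>.
  For univalent harmonic maps this agrees with the topological notion (Lewy).\<close>

definition sense_preserving_on :: "(complex \<Rightarrow> complex) \<Rightarrow> complex set \<Rightarrow> bool" where
  "sense_preserving_on f S \<longleftrightarrow>
    (\<forall>z\<in>S. f differentiable (at z) \<and> (cmod (wirtinger f z))\<^sup>2 - (cmod (wirtinger_bar f z))\<^sup>2 > 0)"

definition starlike_wrt_origin :: "complex set \<Rightarrow> bool" where
  "starlike_wrt_origin S \<longleftrightarrow> 0 \<in> S \<and> (\<forall>w\<in>S. closed_segment 0 w \<subseteq> S)"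

text \<open>\<open>d\<close> is the derivative at \<open>\<theta>\<close> of \<open>arg \<circ> \<gamma>\<close>, where \<open>arg\<close> is multivalued: \<open>d\<close> is the derivative of
  a local branch \<open>\<phi>\<close> of the argument along \<open>\<gamma>\<close>. Since \<open>\<gamma>\<close> does not vanish near \<open>\<theta>\<close>, two branches
  differentiable at \<open>\<theta>\<close> differ near \<open>\<theta>\<close> by a constant, so \<open>d\<close> is unique.\<close>

definition has_arg_derivative :: "(real \<Rightarrow> complex) \<Rightarrow> real \<Rightarrow> real \<Rightarrow> bool" where
  "has_arg_derivative \<gamma> d \<theta> \<longleftrightarrow>
    (\<exists>\<phi>. (\<forall>\<^sub>F t in nhds \<theta>. \<gamma> t \<noteq> 0 \<and> is_Arg (\<gamma> t) (\<phi> t)) \<and> (\<phi> has_real_derivative d) (at \<theta>))"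

definition fully_starlike :: "real \<Rightarrow> (complex \<Rightarrow> complex) \<Rightarrow> bool" where
  "fully_starlike \<beta> f \<longleftrightarrow>
    0 \<le> \<beta> \<and> \<beta> < 1 \<and> f \<in> class_H \<and>
    inj_on f (ball 0 1) \<and> sense_preserving_on f (ball 0 1) \<and>
    open (f ` ball 0 1) \<and> connected (f ` ball 0 1) \<and> starlike_wrt_origin (f ` ball 0 1) \<and>
    (\<forall>r \<theta>. 0 < r \<and> r < 1 \<and> 0 \<le> \<theta> \<and> \<theta> < 2 * pi \<longrightarrow>
       (\<exists>d>\<beta>. has_arg_derivative (\<lambda>t. f (rcis r t)) d \<theta>))"

definition fully_convex :: "real \<Rightarrow> (complex \<Rightarrow> complex) \<Rightarrow> bool" where
  "fully_convex \<beta> f \<longleftrightarrow>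
    0 \<le> \<beta> \<and> \<beta> < 1 \<and> f \<in> class_H \<and>
    inj_on f (ball 0 1) \<and> sense_preserving_on f (ball 0 1) \<and>
    open (f ` ball 0 1) \<and> connected (f ` ball 0 1) \<and> convex (f ` ball 0 1) \<and>
    (\<forall>r \<theta>. 0 < r \<and> r < 1 \<and> 0 \<le> \<theta> \<and> \<theta> < 2 * pi \<longrightarrow>
       (\<exists>d>\<beta>. has_arg_derivative
          (\<lambda>t. vector_derivative (\<lambda>s. f (rcis r s)) (at t)) d \<theta>))"

end

theory Submission
  imports Defs
begin

text \<open>The hypothesis on the coefficients makes \<open>f\<close> a small perturbation of the identity. A weighted
  series \<open>\<Sum>w\<^sub>n a\<^sub>n z\<^sup>n\<close> over \<open>n \<ge> 2\<close> with \<open>|w\<^sub>n| \<le> C n\<^sup>3\<close> is at most \<open>C |z|\<^sup>2\<close> in modulus, and \<open>h\<close>,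
  \<open>z h'\<close> and \<open>z (z h')'\<close> differ from \<open>z\<close> by the series with weights \<open>1\<close>, \<open>n\<close> and \<open>n\<^sup>2\<close>. The relation
  \<open>g' = \<alpha> z h'\<close> carries these bounds over to \<open>g\<close>, so that every estimate is one on \<open>h\<close> alone. In
  particular \<open>f\<close> is the identity plus a contraction and hence univalent (\<open>f_inj\<close>), and
  \<open>|g'| < |h'|\<close> makes it sense-preserving.

  On the circle \<open>z = r e\<^sup>i\<^sup>t\<close> one has \<open>\<partial>f/\<partial>t = \<i> T\<close> with \<open>T = z h' - cnj (z g')\<close>, and
  \<open>\<partial>T/\<partial>t = \<i> T'\<close> with a function \<open>T'\<close> of the same kind. Both \<open>f\<close> and \<open>T\<close> stay within distance
  \<open>r\<close> of \<open>z\<close>, so after division by \<open>e\<^sup>i\<^sup>t\<close> they lie in the right half-plane, where the principal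
  logarithm gives a global smooth branch of their arguments. The two derivatives of arguments are
  \<open>Re (T / f)\<close> and \<open>Re (T' / T)\<close>. That such a real part exceeds \<open>\<beta>\<close> is equivalent to an inequality
  between two moduli (\<open>Re_divide_greater\<close>), which the coefficient bounds provide
  (\<open>radius_rotation\<close>, \<open>tangent_rotation\<close>). At \<open>|\<alpha>| = 2/11\<close> the inequality for \<open>T\<close> degenerates
  at \<open>r = 1\<close> to equality between these bounds; it is strict only because \<open>r < 1\<close>.

  Convexity of the image comes from the rotation of the tangent. As the argument of \<open>T\<close> increases
  by exactly \<open>2 \<pi>\<close> around the circle, the image curve first descends from any of its tangent lines
  and then climbs back, so it stays on one side (\<open>tangent_supports_curve\<close>). The frontier of the
  image of a closed disc lies on this curve, so the image has a supporting line at each frontier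
  point and is convex; the image of the open unit disc is an increasing union of such sets. It
  contains the origin, so its starlikeness follows as well.\<close>

section \<open>Sets with supporting hyperplanes\<close>

text \<open>A point \<open>q\<close> outside \<open>S\<close> is cut off by the supporting hyperplane at the point where the segment
  from the interior point \<open>p\<close> to \<open>q\<close> leaves \<open>S\<close>. So \<open>S\<close> is an intersection of half-spaces.\<close>

lemma convex_if_supported:
  fixes S :: "'a::euclidean_space set"
  assumes "closed S" and "p \<in> interior S"
    and support: "\<And>x. x \<in> frontier S \<Longrightarrow> \<exists>u. u \<noteq> 0 \<and> (\<forall>y\<in>S. u \<bullet> y \<le> u \<bullet> x)"
  shows "convex S"
proof -
  have sep: "\<exists>u c. (\<forall>y\<in>S. u \<bullet> y \<le> c) \<and> c < u \<bullet> q" if "q \<notin> S" for q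
  proof -
    have "p \<in> S" using assms(2) interior_subset by blast
    then have "closed_segment p q \<inter> frontier S \<noteq> {}"
      using that by (intro connected_Int_frontier) auto
    then obtain x where x: "x \<in> closed_segment p q" "x \<in> frontier S" by blast
    obtain u where u: "u \<noteq> 0" "\<forall>y\<in>S. u \<bullet> y \<le> u \<bullet> x" using support[OF x(2)] by blast
    obtain e where e: "e > 0" "cball p e \<subseteq> S"
      using assms(2) by (auto simp: mem_interior_cball)
    define v where "v = p + (e / norm u) *\<^sub>R u"
    have "v \<in> cball p e" using u(1) e(1) by (simp add: v_def dist_norm)
    \<comment> \<open>The hyperplane at \<open>x\<close> misses the interior point \<open>p\<close>, so \<open>u\<close> strictly increases from \<open>p\<close> to \<open>q\<close>.\<close>
    then have "u \<bullet> v \<le> u \<bullet> x" using e u by blast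
    moreover have "u \<bullet> v > u \<bullet> p" using u(1) e(1) by (simp add: v_def inner_add_right)
    ultimately have px: "u \<bullet> p < u \<bullet> x" by simp
    obtain t where t: "0 \<le> t" "t \<le> 1" "x = (1 - t) *\<^sub>R p + t *\<^sub>R q"
      using x(1) by (auto simp: in_segment)
    have eq: "u \<bullet> x = u \<bullet> p + t * (u \<bullet> q - u \<bullet> p)"
      by (simp add: t(3) inner_add_right algebra_simps)
    have tpos: "t * (u \<bullet> q - u \<bullet> p) > 0" using eq px by simp
    then have "u \<bullet> q - u \<bullet> p > 0" using t(1) by (simp add: zero_less_mult_iff)
    moreover have "t \<noteq> 1" using that x t assms(1)
      by (auto simp: frontier_def)
    ultimately have "t * (u \<bullet> q - u \<bullet> p) < u \<bullet> q - u \<bullet> p"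
      using t(2) by simp
    then have "u \<bullet> x < u \<bullet> q" using eq by simp
    with u(2) show ?thesis by blast
  qed
  define H where "H = {{y. u \<bullet> y \<le> c} | u c. \<forall>y\<in>S. u \<bullet> y \<le> c}"
  have "S \<subseteq> \<Inter>H" unfolding H_def by blast
  moreover have "q \<in> S" if q: "q \<in> \<Inter>H" for q
  proof (rule ccontr)
    assume "q \<notin> S"
    then obtain u c where u: "\<forall>y\<in>S. u \<bullet> y \<le> c" "c < u \<bullet> q" using sep by blast
    then have "{y. u \<bullet> y \<le> c} \<in> H" unfolding H_def by blast
    then show False using q u(2) by force
  qed
  ultimately have "S = \<Inter>H" by blast
  moreover have "convex (\<Inter>H)"
    by (rule convex_Inter) (auto simp: H_def intro: convex_halfspace_le)
  ultimately show ?thesis by simp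
qed

text \<open>A nonzero linear functional has no local maximum at an interior point, so its maximum over a
  compact set is attained on the frontier.\<close>

lemma inner_le_if_frontier_le:
  fixes K :: "'a::euclidean_space set"
  assumes "compact K" and "u \<noteq> 0" and le: "\<And>x. x \<in> frontier K \<Longrightarrow> u \<bullet> x \<le> c" and "y \<in> K"
  shows "u \<bullet> y \<le> c"
proof -
  have "continuous_on K (\<lambda>x. u \<bullet> x)" by (intro continuous_intros)
  then obtain m where m: "m \<in> K" "\<And>x. x \<in> K \<Longrightarrow> u \<bullet> x \<le> u \<bullet> m"
    using continuous_attains_sup[OF assms(1)] assms(4) by blast
  have "m \<notin> interior K"
  proof
    assume "m \<in> interior K"
    then obtain e where e: "e > 0" "cball m e \<subseteq> K" by (auto simp: mem_interior_cball)
    have "m + (e / norm u) *\<^sub>R u \<in> cball m e" using assms(2) e(1) by (simp add: dist_norm)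
    then have "u \<bullet> (m + (e / norm u) *\<^sub>R u) \<le> u \<bullet> m" using e m by blast
    moreover have "e / norm u * (u \<bullet> u) > 0" using assms(2) e(1) by simp
    ultimately show False by (simp add: inner_add_right)
  qed
  then have "m \<in> frontier K" using m(1) closure_subset by (auto simp: frontier_def)
  then show ?thesis using le m(2)[OF assms(4)] by force
qed

section \<open>The argument along a curve\<close>

text \<open>A branch of the argument of \<open>F\<close> for a curve that stays in the half-plane about the rotating
  direction \<open>cis t\<close>. If \<open>F\<close> has period \<open>2 * pi\<close>, so has the logarithmic term, and the branch gains
  exactly \<open>2 * pi\<close> over a period.\<close>

definition arg_along :: "(real \<Rightarrow> complex) \<Rightarrow> real \<Rightarrow> real" where
  "arg_along F t = t + Im (Ln (F t * cis (- t)))"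

lemma is_Arg_arg_along:
  assumes "Re (F t * cis (- t)) > 0"
  shows "is_Arg (F t) (arg_along F t)"
proof -
  let ?w = "F t * cis (- t)"
  have "?w \<noteq> 0" using assms by force
  then have "?w = of_real (cmod ?w) * exp (\<i> * of_real (Im (Ln ?w)))"
    by (metis exp_Ln exp_eq_polar cis_conv_exp norm_exp_eq_Re)
  then have "?w = of_real (cmod (F t)) * cis (Im (Ln ?w))"
    by (simp add: norm_mult cis_conv_exp)
  then have "?w * cis t = of_real (cmod (F t)) * cis (Im (Ln ?w)) * cis t" by simp
  moreover have "?w * cis t = F t" by (simp add: mult.assoc cis_mult)
  ultimately have "F t = of_real (cmod (F t)) * cis (arg_along F t)"
    by (simp add: arg_along_def mult.assoc cis_mult add.commute)
  then show ?thesis unfolding is_Arg_def cis_conv_exp .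
qed

lemma has_real_derivative_arg_along:
  assumes F: "(F has_vector_derivative \<i> * N) (at t)" and pos: "Re (F t * cis (- t)) > 0"
  shows "(arg_along F has_real_derivative Re (N / F t)) (at t)"
proof -
  let ?w = "F t * cis (- t)"
  have nz: "F t \<noteq> 0" using pos by force
  have c: "((\<lambda>t. cis (- t)) has_vector_derivative - \<i> * cis (- t)) (at t)"
    unfolding has_vector_derivative_def
    by (rule derivative_eq_intros | simp)+
  have "((\<lambda>t. F t * cis (- t)) has_vector_derivative
      F t * (- \<i> * cis (- t)) + \<i> * N * cis (- t)) (at t)"
    by (rule has_vector_derivative_mult[OF F c])
  moreover have "?w \<notin> \<real>\<^sub>\<le>\<^sub>0" using pos complex_nonpos_Reals_iff not_less by blast
  ultimately have "((Ln \<circ> (\<lambda>t. F t * cis (- t))) has_vector_derivative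
      (F t * (- \<i> * cis (- t)) + \<i> * N * cis (- t)) * inverse ?w) (at t)"
    by (intro field_vector_diff_chain_at has_field_derivative_Ln)
  moreover have "(F t * (- \<i> * cis (- t)) + \<i> * N * cis (- t)) * inverse ?w = \<i> * (N / F t - 1)"
    using nz by (simp add: field_simps)
  ultimately have "((\<lambda>t. Ln (F t * cis (- t))) has_vector_derivative \<i> * (N / F t - 1)) (at t)"
    by (simp add: o_def)
  then have "((\<lambda>t. Im (Ln (F t * cis (- t)))) has_vector_derivative Im (\<i> * (N / F t - 1))) (at t)"
    by (rule bounded_linear.has_vector_derivative[OF bounded_linear_Im])
  then have "((\<lambda>t. Im (Ln (F t * cis (- t)))) has_real_derivative Re (N / F t) - 1) (at t)"
    by (simp add: has_real_derivative_iff_has_vector_derivative)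
  from DERIV_add[OF DERIV_ident this] show ?thesis by (simp add: arg_along_def[abs_def])
qed

lemma has_arg_derivative_along:
  assumes "(F has_vector_derivative \<i> * N) (at t)" and pos: "\<And>s. Re (F s * cis (- s)) > 0"
  shows "has_arg_derivative F (Re (N / F t)) t"
  unfolding has_arg_derivative_def
proof (intro exI conjI)
  have "F s \<noteq> 0 \<and> is_Arg (F s) (arg_along F s)" for s
    using pos[of s] is_Arg_arg_along[of F s] by auto
  then show "\<forall>\<^sub>F s in nhds t. F s \<noteq> 0 \<and> is_Arg (F s) (arg_along F s)" by simp
qed (rule has_real_derivative_arg_along[OF assms(1) pos])

lemma has_arg_derivative_cmult_ii:
  assumes "has_arg_derivative F d t"
  shows "has_arg_derivative (\<lambda>s. \<i> * F s) d t"
proof -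
  obtain \<phi> where \<phi>: "\<forall>\<^sub>F s in nhds t. F s \<noteq> 0 \<and> is_Arg (F s) (\<phi> s)" "(\<phi> has_real_derivative d) (at t)"
    using assms by (auto simp: has_arg_derivative_def)
  have rot: "is_Arg (\<i> * w) (x + pi / 2)" if "is_Arg w x" for w x
  proof -
    have "w = of_real (cmod w) * cis x" using that by (simp add: is_Arg_def cis_conv_exp)
    then have "\<i> * w = of_real (cmod w) * (cis x * cis (pi / 2))" by (simp add: mult_ac)
    then have "\<i> * w = of_real (cmod (\<i> * w)) * cis (x + pi / 2)"
      by (simp only: cis_mult norm_mult) simp
    then show ?thesis unfolding is_Arg_def cis_conv_exp .
  qed
  show ?thesis unfolding has_arg_derivative_def
  proof (intro exI conjI)
    show "\<forall>\<^sub>F s in nhds t. \<i> * F s \<noteq> 0 \<and> is_Arg (\<i> * F s) (\<phi> s + pi / 2)"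
      using \<phi>(1) by eventually_elim (auto intro: rot)
    show "((\<lambda>s. \<phi> s + pi / 2) has_real_derivative d) (at t)"
      using \<phi>(2) by (auto intro!: derivative_eq_intros)
  qed
qed

lemma Re_mult_cis_pos:
  assumes "cmod (w - rcis r t) < r"
  shows "Re (w * cis (- t)) > 0"
proof -
  have "(w - rcis r t) * cis (- t) = w * cis (- t) - of_real r"
    by (simp add: rcis_def algebra_simps cis_mult)
  moreover have "cmod ((w - rcis r t) * cis (- t)) < r" using assms by (simp add: norm_mult)
  ultimately show ?thesis using abs_Re_le_cmod[of "w * cis (- t) - of_real r"] by simp
qed

text \<open>The half-plane \<open>Re w > \<beta>\<close> consists of the points that are closer to \<open>1\<close> than to the mirror
  image \<open>2 * \<beta> - 1\<close> of \<open>1\<close> in its boundary line. In this form only moduli of linear expressions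
  in \<open>N\<close> and \<open>D\<close> have to be estimated.\<close>

lemma Re_divide_greater:
  fixes N D :: complex
  assumes "cmod (N - D) < cmod (N + of_real (1 - 2 * \<beta>) * D)" and "D \<noteq> 0" and "\<beta> < 1"
  shows "\<beta> < Re (N / D)"
proof -
  let ?w = "N / D"
  have "cmod (?w - 1) * cmod D < cmod (?w + of_real (1 - 2 * \<beta>)) * cmod D"
    using assms(1,2) by (simp flip: norm_mult add: algebra_simps)
  then have "cmod (?w - 1) < cmod (?w + of_real (1 - 2 * \<beta>))"
    by (simp add: mult_less_cancel_right)
  then have "(cmod (?w - 1))\<^sup>2 < (cmod (?w + of_real (1 - 2 * \<beta>)))\<^sup>2"
    by (intro power_strict_mono) auto
  then have "(1 - \<beta>) * (Re ?w - \<beta>) > 0"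
    unfolding cmod_power2 by (simp add: power2_eq_square algebra_simps)
  then show ?thesis using assms(3) by (simp add: zero_less_mult_iff)
qed

text \<open>The component of the velocity along the outer normal \<open>T s\<close> is a negative multiple of the sine of
  the angle by which the tangent has turned since \<open>s\<close>. This angle increases from \<open>0\<close> to \<open>2 * pi\<close>,
  so the sine changes sign once.\<close>

lemma tangent_supports_curve:
  fixes \<gamma> T N :: "real \<Rightarrow> complex"
  assumes \<gamma>: "\<And>t. (\<gamma> has_vector_derivative \<i> * T t) (at t)"
    and T: "\<And>t. (T has_vector_derivative \<i> * N t) (at t)"
    and pos: "\<And>t. Re (T t * cis (- t)) > 0"
    and turn: "\<And>t. Re (N t / T t) > 0"
    and period: "\<gamma> (s + 2 * pi) = \<gamma> s" "T (s + 2 * pi) = T s"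
    and t: "s \<le> t" "t \<le> s + 2 * pi"
  shows "T s \<bullet> \<gamma> t \<le> T s \<bullet> \<gamma> s"
proof -
  define \<psi> where "\<psi> = arg_along T"
  have \<psi>': "(\<psi> has_real_derivative Re (N t / T t)) (at t)" for t
    unfolding \<psi>_def by (rule has_real_derivative_arg_along[OF T pos])
  have mono: "\<psi> x \<le> \<psi> y" if "x \<le> y" for x y
    using that DERIV_pos_imp_increasing[of x y \<psi>] \<psi>' turn by (cases "x = y") force+
  have full: "\<psi> (s + 2 * pi) = \<psi> s + 2 * pi"
  proof -
    have "cis (- (s + 2 * pi)) = cis (- s)" by (simp add: complex_eq_iff sin_diff cos_diff)
    then show ?thesis by (simp add: \<psi>_def arg_along_def period)
  qed
  have polar: "T t = of_real (cmod (T t)) * cis (\<psi> t)" for t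
    using is_Arg_arg_along[of T t, OF pos] by (simp add: is_Arg_def \<psi>_def cis_conv_exp)
  define \<phi> where "\<phi> t = T s \<bullet> \<gamma> t" for t
  have \<phi>': "(\<phi> has_real_derivative - (cmod (T s) * cmod (T t) * sin (\<psi> t - \<psi> s))) (at t)" for t
  proof -
    have "(\<phi> has_vector_derivative T s \<bullet> (\<i> * T t)) (at t)"
      unfolding \<phi>_def by (rule bounded_linear.has_vector_derivative[OF bounded_linear_inner_right \<gamma>])
    moreover have "T s \<bullet> (\<i> * T t) = - (cmod (T s) * cmod (T t) * sin (\<psi> t - \<psi> s))"
      by (subst polar[of s], subst polar[of t])
        (simp add: inner_complex_def sin_diff algebra_simps)
    ultimately show ?thesis by (simp add: has_real_derivative_iff_has_vector_derivative)
  qed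
  have cont: "continuous_on A \<psi>" for A
    using \<psi>' by (meson DERIV_isCont continuous_at_imp_continuous_on)
  obtain m where m: "s \<le> m" "m \<le> s + 2 * pi" "\<psi> m = \<psi> s + pi"
    using IVT'[of \<psi> s "\<psi> s + pi" "s + 2 * pi"] full cont by auto
  \<comment> \<open>Up to \<open>m\<close> the tangent has turned by at most \<open>\<pi>\<close>, afterwards by at least \<open>\<pi>\<close>.\<close>
  show ?thesis
  proof (cases "t \<le> m")
    case True
    have "\<phi> t \<le> \<phi> s"
    proof (rule DERIV_nonpos_imp_nonincreasing[OF t(1)])
      fix x assume x: "s \<le> x" "x \<le> t"
      have "sin (\<psi> x - \<psi> s) \<ge> 0"
        using mono[OF x(1)] mono[of x m] m x True by (intro sin_ge_zero) auto
      then show "\<exists>y. (\<phi> has_real_derivative y) (at x) \<and> y \<le> 0"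
        using \<phi>'[of x] by (intro exI conjI) auto
    qed
    then show ?thesis by (simp add: \<phi>_def)
  next
    case False
    have "\<phi> t \<le> \<phi> (s + 2 * pi)"
    proof (rule DERIV_nonneg_imp_nondecreasing[OF t(2)])
      fix x assume x: "t \<le> x" "x \<le> s + 2 * pi"
      have "sin (\<psi> x - \<psi> s) \<le> 0"
      proof (cases "\<psi> x - \<psi> s = 2 * pi")
        case nf: False
        then show ?thesis
          using mono[OF x(2)] mono[of m x] m x False full by (intro sin_le_zero) auto
      qed simp
      then show "\<exists>y. (\<phi> has_real_derivative y) (at x) \<and> 0 \<le> y"
        using \<phi>'[of x] by (intro exI conjI) (auto simp: mult_nonneg_nonpos)
    qed
    then show ?thesis by (simp add: \<phi>_def period)
  qed
qed

section \<open>Weighted power series\<close>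

lemma euler_operator_sums:
  fixes F :: "complex \<Rightarrow> complex"
  assumes "F holomorphic_on ball 0 1"
    and sums: "\<And>z. z \<in> ball 0 1 \<Longrightarrow> (\<lambda>n. c n * z ^ n) sums F z" and z: "z \<in> ball 0 1"
  shows "(\<lambda>n. (of_nat n * c n) * z ^ n) sums (z * deriv F z)"
proof -
  have "(F has_field_derivative deriv F z) (at z)"
    using assms(1) z holomorphic_derivI by blast
  then have "(\<lambda>n. diffs c n * z ^ n) sums deriv F z"
    using z sums by (intro termdiffs_sums_strong[where K = 1 and f = F]) auto
  then have "(\<lambda>n. z * (diffs c n * z ^ n)) sums (z * deriv F z)" by (rule sums_mult)
  then have "(\<lambda>n. (of_nat (Suc n) * c (Suc n)) * z ^ Suc n) sums (z * deriv F z)"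
    by (simp add: diffs_def mult_ac)
  then show ?thesis by (subst (asm) sums_Suc_iff) simp
qed

text \<open>The series starts at \<open>n = 2\<close>, so \<open>|z|\<^sup>n \<le> |z|\<^sup>2\<close>; the weights are absorbed by the cubic ones.
  The factor \<open>|z|\<^sup>2\<close> rather than \<open>|z|\<close> is what later makes borderline inequalities strict.\<close>

lemma norm_weighted_sums_le:
  fixes c :: "nat \<Rightarrow> complex" and w :: "nat \<Rightarrow> real"
  assumes c: "c 0 = 0" "c 1 = 0"
    and sm: "summable (\<lambda>n. real n ^ 3 * cmod (c n))" and le1: "(\<Sum>n. real n ^ 3 * cmod (c n)) \<le> 1"
    and w: "\<And>n. n \<ge> 2 \<Longrightarrow> \<bar>w n\<bar> \<le> C * real n ^ 3" and C: "C \<ge> 0"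
    and z: "cmod z \<le> 1" and S: "(\<lambda>n. (of_real (w n) * c n) * z ^ n) sums S"
  shows "cmod S \<le> C * (cmod z)\<^sup>2"
proof -
  have b: "cmod ((of_real (w n) * c n) * z ^ n) \<le> (C * (cmod z)\<^sup>2) * (real n ^ 3 * cmod (c n))" for n
  proof (cases "n \<ge> 2")
    case True
    have "cmod z ^ n \<le> (cmod z)\<^sup>2" using True z by (intro power_decreasing) auto
    then have "\<bar>w n\<bar> * cmod z ^ n \<le> (C * real n ^ 3) * (cmod z)\<^sup>2"
      using w[OF True] C by (intro mult_mono) auto
    then have "(\<bar>w n\<bar> * cmod z ^ n) * cmod (c n) \<le> ((C * real n ^ 3) * (cmod z)\<^sup>2) * cmod (c n)"
      by (intro mult_right_mono) auto
    then show ?thesis by (simp add: norm_mult norm_power mult_ac)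
  next
    case False
    then have "n = 0 \<or> n = 1" by auto
    then have "c n = 0" using c by blast
    then show ?thesis by simp
  qed
  have "cmod S = cmod (\<Sum>n. (of_real (w n) * c n) * z ^ n)" using S sums_unique by metis
  also have "\<dots> \<le> (\<Sum>n. (C * (cmod z)\<^sup>2) * (real n ^ 3 * cmod (c n)))"
    by (rule norm_suminf_le[OF b summable_mult[OF sm]])
  also have "\<dots> = (C * (cmod z)\<^sup>2) * (\<Sum>n. real n ^ 3 * cmod (c n))"
    by (rule suminf_mult[OF sm])
  also have "\<dots> \<le> (C * (cmod z)\<^sup>2) * 1" using C le1 by (intro mult_left_mono) auto
  finally show ?thesis by simp
qed

section \<open>Estimates for the harmonic map\<close>

text \<open>The numbers \<open>c n\<close> are the Taylor coefficients of \<open>h z - z\<close>, those of index \<open>0\<close> and \<open>1\<close> included,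
  so that \<open>z * d/dz\<close> acts on them as multiplication by \<open>n\<close>.\<close>

locale cubic_shear =
  fixes f h g :: "complex \<Rightarrow> complex" and c :: "nat \<Rightarrow> complex" and \<alpha> :: complex
  assumes f_eq: "\<And>z. z \<in> ball 0 1 \<Longrightarrow> f z = h z + cnj (g z)"
    and h_holo: "h holomorphic_on ball 0 1" and g_holo: "g holomorphic_on ball 0 1"
    and series: "\<And>z. z \<in> ball 0 1 \<Longrightarrow> (\<lambda>n. c n * z ^ n) sums (h z - z)"
    and c01: "c 0 = 0" "c 1 = 0"
    and summ: "summable (\<lambda>n. real n ^ 3 * cmod (c n))"
    and sum_le: "(\<Sum>n. real n ^ 3 * cmod (c n)) \<le> 1"
    and g0: "g 0 = 0"
    and shear: "\<And>z. z \<in> ball 0 1 \<Longrightarrow> deriv g z = \<alpha> * z * deriv h z"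
    and alpha: "cmod \<alpha> \<le> 2 / 11"
begin

text \<open>The deviations of \<open>h\<close>, \<open>z h'\<close> and \<open>z (z h')'\<close> from \<open>z\<close>: the series with the coefficients
  \<open>c n\<close>, \<open>n * c n\<close> and \<open>n\<^sup>2 * c n\<close>.\<close>

definition "E0 z = h z - z"
definition "E1 z = z * deriv E0 z"
definition "E2 z = z * deriv E1 z"

lemma holo: "E0 holomorphic_on ball 0 1" "E1 holomorphic_on ball 0 1"
proof -
  show "E0 holomorphic_on ball 0 1" unfolding E0_def by (intro holomorphic_intros h_holo)
  then show "E1 holomorphic_on ball 0 1" unfolding E1_def by (intro holomorphic_intros) auto
qed

lemma E_combination_bound:
  assumes w: "\<And>x::real. x \<ge> 2 \<Longrightarrow> \<bar>u + v * x + w * x\<^sup>2\<bar> \<le> C * x ^ 3" and z: "z \<in> ball 0 1"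
  shows "cmod (of_real u * E0 z + of_real v * E1 z + of_real w * E2 z) \<le> C * (cmod z)\<^sup>2"
proof (rule norm_weighted_sums_le[OF c01 summ sum_le])
  have s0: "(\<lambda>n. c n * z ^ n) sums E0 z" if "z \<in> ball 0 1" for z
    using series[OF that] by (simp add: E0_def)
  have s1: "(\<lambda>n. (of_nat n * c n) * z ^ n) sums E1 z" if "z \<in> ball 0 1" for z
    unfolding E1_def by (rule euler_operator_sums[OF holo(1) s0 that])
  have s2: "(\<lambda>n. (of_nat n * (of_nat n * c n)) * z ^ n) sums E2 z"
    unfolding E2_def by (rule euler_operator_sums[OF holo(2) s1 z])
  show "(\<lambda>n. (of_real (u + v * real n + w * (real n)\<^sup>2) * c n) * z ^ n) sums
      (of_real u * E0 z + of_real v * E1 z + of_real w * E2 z)"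
    using sums_add[OF sums_add[OF sums_mult[OF s0[OF z], of "of_real u"]
        sums_mult[OF s1[OF z], of "of_real v"]] sums_mult[OF s2, of "of_real w"]]
    by (simp add: algebra_simps power2_eq_square)
  show "\<bar>u + v * real n + w * (real n)\<^sup>2\<bar> \<le> C * real n ^ 3" if "n \<ge> 2" for n
    using w[of "real n"] that by simp
  show "C \<ge> 0" using w[of 2] by simp
  show "cmod z \<le> 1" using z by simp
qed

text \<open>Each constant is the largest quotient of the corresponding weight by \<open>n\<^sup>3\<close> over \<open>n \<ge> 2\<close>,
  attained at \<open>n = 2\<close>. The differences get bounds of their own because the triangle inequality would
  be too lossy for the stated orders.\<close>

lemma E_bounds:
  assumes z: "z \<in> ball 0 1"
  shows "cmod (E0 z) \<le> 1 / 8 * (cmod z)\<^sup>2" "cmod (E1 z) \<le> 1 / 4 * (cmod z)\<^sup>2"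
    "cmod (E2 z) \<le> 1 / 2 * (cmod z)\<^sup>2"
    "cmod (E1 z - E0 z) \<le> 1 / 8 * (cmod z)\<^sup>2" "cmod (E2 z - E1 z) \<le> 1 / 4 * (cmod z)\<^sup>2"
    "cmod (E2 z + 2 * E1 z) \<le> (cmod z)\<^sup>2"
proof -
  have
    "1 \<le> 1 / 8 * x ^ 3" "x \<le> 1 / 4 * x ^ 3" "x\<^sup>2 \<le> 1 / 2 * x ^ 3"
    "x - 1 \<le> 1 / 8 * x ^ 3" "x\<^sup>2 - x \<le> 1 / 4 * x ^ 3" "x\<^sup>2 + 2 * x \<le> x ^ 3" "x \<le> x\<^sup>2"
    if x: "x \<ge> 2" for x :: real
  proof -
    have sq: "2 * x \<le> x\<^sup>2" using x by (simp add: power2_eq_square)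
    have cube: "2 * x\<^sup>2 \<le> x ^ 3" using x by (simp add: power2_eq_square power3_eq_cube)
    \<comment> \<open>The three products are multiples of the differences of the two sides, all of which vanish at \<open>2\<close>.\<close>
    have f: "0 \<le> (x - 2) * (x\<^sup>2 + 2 * x - 4)" "0 \<le> x * (x - 2)\<^sup>2"
      "0 \<le> x * (x - 2) * (x + 1)"
      using sq x by (auto intro!: mult_nonneg_nonneg)
    show "x - 1 \<le> 1 / 8 * x ^ 3" "x\<^sup>2 - x \<le> 1 / 4 * x ^ 3" "x\<^sup>2 + 2 * x \<le> x ^ 3"
      using f by (simp_all add: power2_eq_square power3_eq_cube algebra_simps)
    show "1 \<le> 1 / 8 * x ^ 3" "x \<le> 1 / 4 * x ^ 3" "x\<^sup>2 \<le> 1 / 2 * x ^ 3" "x \<le> x\<^sup>2"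
      using sq cube x by linarith+
  qed
  note x = this
  show "cmod (E0 z) \<le> 1 / 8 * (cmod z)\<^sup>2"
    using E_combination_bound[OF _ z, of 1 0 0 "1/8"] x(1) by simp
  show "cmod (E1 z) \<le> 1 / 4 * (cmod z)\<^sup>2"
    using E_combination_bound[OF _ z, of 0 1 0 "1/4"] x(2) by simp
  show "cmod (E2 z) \<le> 1 / 2 * (cmod z)\<^sup>2"
    using E_combination_bound[OF _ z, of 0 0 1 "1/2"] x(3) by simp
  show "cmod (E1 z - E0 z) \<le> 1 / 8 * (cmod z)\<^sup>2"
    using E_combination_bound[OF _ z, of "-1" 1 0 "1/8"] x(4) by simp
  show "cmod (E2 z - E1 z) \<le> 1 / 4 * (cmod z)\<^sup>2"
    using E_combination_bound[OF _ z, of 0 "-1" 1 "1/4"] x(5,7) by simp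
  show "cmod (E2 z + 2 * E1 z) \<le> (cmod z)\<^sup>2"
    using E_combination_bound[OF _ z, of 0 2 1 1] x(6) by (simp add: add.commute)
qed

lemma h_deriv:
  assumes z: "z \<in> ball 0 1"
  shows "(h has_field_derivative deriv h z) (at z)" "deriv E0 z = deriv h z - 1"
    "z * deriv h z = z + E1 z"
proof -
  show d: "(h has_field_derivative deriv h z) (at z)"
    using h_holo z holomorphic_derivI by blast
  show e: "deriv E0 z = deriv h z - 1"
    unfolding E0_def by (rule DERIV_imp_deriv) (auto intro!: derivative_eq_intros d)
  show "z * deriv h z = z + E1 z" by (simp add: E1_def e algebra_simps)
qed

lemma g_deriv:
  assumes z: "z \<in> ball 0 1"
  shows "(g has_field_derivative deriv g z) (at z)" "deriv g z = \<alpha> * (z + E1 z)"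
    "cmod (deriv g z) \<le> 5 / 4 * cmod \<alpha> * cmod z"
proof -
  show "(g has_field_derivative deriv g z) (at z)"
    using g_holo z holomorphic_derivI by blast
  show e: "deriv g z = \<alpha> * (z + E1 z)"
    using shear[OF z] h_deriv(3)[OF z] by (simp add: mult.assoc)
  have "(cmod z)\<^sup>2 \<le> cmod z" using z by (simp add: power2_eq_square mult_left_le)
  then have "cmod (z + E1 z) \<le> 5 / 4 * cmod z"
    using norm_triangle_ineq[of z "E1 z"] E_bounds(2)[OF z] by simp
  then have "cmod \<alpha> * cmod (z + E1 z) \<le> cmod \<alpha> * (5 / 4 * cmod z)"
    by (rule mult_left_mono) simp
  then show "cmod (deriv g z) \<le> 5 / 4 * cmod \<alpha> * cmod z" by (simp add: e norm_mult)
qed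

lemma deriv_E0_bound:
  assumes z: "z \<in> ball 0 1"
  shows "cmod (deriv E0 z) \<le> 1 / 4"
proof (cases "z = 0")
  case True
  have "(\<lambda>n. diffs c n * 0 ^ n) sums deriv E0 0"
    by (rule termdiffs_sums_strong[where K = 1 and f = E0])
      (use series holomorphic_derivI[OF holo(1)] in \<open>auto simp: E0_def\<close>)
  then show ?thesis using True c01 by (simp add: diffs_def)
next
  case False
  have "cmod z * cmod (deriv E0 z) \<le> cmod z * (1 / 4 * cmod z)"
    using E_bounds(2)[OF z] by (simp add: E1_def norm_mult power2_eq_square mult_ac)
  then have "cmod (deriv E0 z) \<le> 1 / 4 * cmod z" using False by simp
  then show ?thesis using z by simp
qed

lemma deriv_g_bound:
  assumes z: "z \<in> ball 0 1"
  shows "cmod (deriv g z) \<le> 1 / 4"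
proof -
  have "cmod \<alpha> * cmod z \<le> 2 / 11 * 1" using alpha z by (intro mult_mono) auto
  then show ?thesis using g_deriv(3)[OF z] by simp
qed

lemma g_bound:
  assumes z: "z \<in> ball 0 1"
  shows "cmod (g z) \<le> 5 / 4 * cmod \<alpha> * (cmod z)\<^sup>2"
proof -
  have "cmod (g z - g 0) \<le> (5 / 4 * cmod \<alpha> * cmod z) * cmod (z - 0)"
  proof (rule field_differentiable_bound[where S = "cball 0 (cmod z)"])
    fix w :: complex assume "w \<in> cball 0 (cmod z)"
    then have w: "w \<in> ball 0 1" "cmod w \<le> cmod z" using z by auto
    show "(g has_field_derivative deriv g w) (at w within cball 0 (cmod z))"
      using g_deriv(1)[OF w(1)] by (rule has_field_derivative_at_within)
    have "5 / 4 * cmod \<alpha> * cmod w \<le> 5 / 4 * cmod \<alpha> * cmod z"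
      using w(2) by (intro mult_left_mono) auto
    then show "cmod (deriv g w) \<le> 5 / 4 * cmod \<alpha> * cmod z" using g_deriv(3)[OF w(1)] by simp
  qed auto
  then show ?thesis by (simp add: g0 power2_eq_square mult_ac)
qed

section \<open>Univalence\<close>

text \<open>The differences of \<open>E0\<close> and of \<open>g\<close> contribute at most a quarter of \<open>|z - w|\<close> each, which cannot
  cancel the difference of the identity parts.\<close>

lemma f_inj: "inj_on f (ball 0 1)"
proof (rule inj_onI, rule ccontr)
  fix z w assume zw: "z \<in> ball 0 1" "w \<in> ball 0 1" "f z = f w" "z \<noteq> w"
  have e: "cmod (E0 z - E0 w) \<le> 1 / 4 * cmod (z - w)"
    by (rule field_differentiable_bound[where S = "ball 0 1" and f' = "deriv E0"])
      (use zw deriv_E0_bound holomorphic_derivI[OF holo(1)] in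
        \<open>auto intro: has_field_derivative_at_within\<close>)
  have g: "cmod (g z - g w) \<le> 1 / 4 * cmod (z - w)"
    by (rule field_differentiable_bound[where S = "ball 0 1" and f' = "deriv g"])
      (use zw deriv_g_bound g_deriv(1) in \<open>auto intro: has_field_derivative_at_within\<close>)
  have "w - z = (E0 z - E0 w) + cnj (g z - g w)"
    using zw by (simp add: f_eq E0_def algebra_simps)
  then have "cmod (z - w) \<le> cmod (E0 z - E0 w) + cmod (g z - g w)"
    by (metis complex_mod_cnj norm_minus_commute norm_triangle_ineq)
  moreover have "cmod (z - w) > 0" using zw(4) by simp
  ultimately show False using e g by linarith
qed

lemma f_has_derivative:
  assumes z: "z \<in> ball 0 1"
  shows "(f has_derivative (\<lambda>w. deriv h z * w + cnj (deriv g z * w))) (at z)"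
proof -
  have "((\<lambda>z. h z + cnj (g z)) has_derivative (\<lambda>w. deriv h z * w + cnj (deriv g z * w))) (at z)"
    using h_deriv(1)[OF z] g_deriv(1)[OF z] unfolding has_field_derivative_def
    by (intro has_derivative_add bounded_linear.has_derivative[OF bounded_linear_cnj]) auto
  then show ?thesis
    by (rule has_derivative_transform_within_open[of _ _ _ _ "ball 0 1"]) (use z f_eq in auto)
qed

text \<open>The Wirtinger derivatives are \<open>h'\<close> and \<open>cnj g'\<close>, with \<open>|h'| \<ge> 3/4\<close> and \<open>|g'| \<le> 1/4\<close>.\<close>

lemma f_sense_preserving: "sense_preserving_on f (ball 0 1)"
  unfolding sense_preserving_on_def
proof (intro ballI conjI)
  fix z :: complex assume z: "z \<in> ball 0 1"
  note d = f_has_derivative[OF z]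
  show "f differentiable at z" using d differentiableI by blast
  have fr: "frechet_derivative f (at z) = (\<lambda>w. deriv h z * w + cnj (deriv g z * w))"
    using frechet_derivative_at[OF d] by simp
  have "wirtinger f z = deriv h z" "wirtinger_bar f z = cnj (deriv g z)"
    by (simp_all add: wirtinger_def wirtinger_bar_def fr algebra_simps)
  moreover have "cmod (deriv h z) \<ge> 3 / 4"
    using deriv_E0_bound[OF z] norm_triangle_ineq2[of 1 "1 - deriv h z"] h_deriv(2)[OF z]
    by (simp add: norm_minus_commute)
  then have "cmod (deriv g z) < cmod (deriv h z)" using deriv_g_bound[OF z] by simp
  then have "(cmod (deriv g z))\<^sup>2 < (cmod (deriv h z))\<^sup>2" by (intro power_strict_mono) auto
  ultimately show "(cmod (wirtinger f z))\<^sup>2 - (cmod (wirtinger_bar f z))\<^sup>2 > 0" by simp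
qed

lemma f_continuous: "continuous_on (ball 0 1) f"
  using f_has_derivative has_derivative_continuous continuous_at_imp_continuous_on by blast

lemma f_open:
  assumes "S \<subseteq> ball 0 1" and "open S"
  shows "open (f ` S)"
  using assms f_continuous f_inj
  by (intro invariance_of_domain) (auto intro: continuous_on_subset inj_on_subset)

section \<open>Rotation of the radius vector and of the tangent\<close>

text \<open>By \<open>h_deriv\<close>, \<open>T z = z * h' z - cnj (z * g' z)\<close>: the velocity of \<open>f\<close> along the circle through
  \<open>z\<close>, divided by \<open>\<i>\<close>. So \<open>T\<close> is an outer normal of the image curve.\<close>

definition "T z = (z + E1 z) - cnj (z * deriv g z)"

text \<open>The derivative of \<open>T\<close> along the circle through \<open>z\<close>, divided by \<open>\<i>\<close>, with \<open>g'\<close> expressed through \<open>h'\<close>.\<close>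

definition "T' z = (z + E2 z) + cnj (\<alpha> * z * (2 * z + E1 z + E2 z))"

lemma has_vector_derivative_circle:
  assumes "F holomorphic_on ball 0 1" and "0 \<le> r" "r < 1"
  shows "((\<lambda>t. F (rcis r t)) has_vector_derivative \<i> * (rcis r t * deriv F (rcis r t))) (at t)"
proof -
  have "(rcis r has_vector_derivative \<i> * rcis r t) (at t)"
    unfolding has_vector_derivative_def rcis_def
    by (rule derivative_eq_intros | simp add: scaleR_conv_of_real mult_ac)+
  moreover have "(F has_field_derivative deriv F (rcis r t)) (at (rcis r t))"
    using assms by (intro holomorphic_derivI[OF assms(1)]) auto
  ultimately have "((F \<circ> rcis r) has_vector_derivative (\<i> * rcis r t) * deriv F (rcis r t)) (at t)"
    by (rule field_vector_diff_chain_at)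
  then show ?thesis by (simp add: o_def mult.assoc)
qed

lemma f_circle:
  assumes r: "0 \<le> r" "r < 1"
  shows "((\<lambda>t. f (rcis r t)) has_vector_derivative \<i> * T (rcis r t)) (at t)"
proof -
  have b: "rcis r t \<in> ball 0 1" for t using r by simp
  have "((\<lambda>t. h (rcis r t) + cnj (g (rcis r t))) has_vector_derivative
      \<i> * (rcis r t * deriv h (rcis r t)) + cnj (\<i> * (rcis r t * deriv g (rcis r t)))) (at t)"
    by (intro has_vector_derivative_add has_vector_derivative_circle[OF _ r] h_holo g_holo
        bounded_linear.has_vector_derivative[OF bounded_linear_cnj])
  then show ?thesis using f_eq[OF b] h_deriv(3)[OF b] by (simp add: T_def algebra_simps)
qed

lemma T_circle:
  assumes r: "0 \<le> r" "r < 1"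
  shows "((\<lambda>t. T (rcis r t)) has_vector_derivative \<i> * T' (rcis r t)) (at t)"
proof -
  have b: "rcis r t \<in> ball 0 1" for t using r by simp
  define p where "p z = z + E1 z" for z
  define q where "q z = \<alpha> * (z * p z)" for z
  have p: "p holomorphic_on ball 0 1" unfolding p_def by (intro holomorphic_intros holo)
  then have q: "q holomorphic_on ball 0 1" unfolding q_def by (intro holomorphic_intros)
  have dp: "deriv p z = 1 + deriv E1 z" if "z \<in> ball 0 1" for z
    unfolding p_def
    by (rule DERIV_imp_deriv)
      (use that holomorphic_derivI[OF holo(2)] in \<open>auto intro!: derivative_eq_intros\<close>)
  have dq: "deriv q z = \<alpha> * (p z + z * deriv p z)" if "z \<in> ball 0 1" for z
    unfolding q_def
    by (rule DERIV_imp_deriv)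
      (use that holomorphic_derivI[OF p] in \<open>auto intro!: derivative_eq_intros\<close>)
  have "((\<lambda>t. p (rcis r t) - cnj (q (rcis r t))) has_vector_derivative
      \<i> * (rcis r t * deriv p (rcis r t)) - cnj (\<i> * (rcis r t * deriv q (rcis r t)))) (at t)"
    by (intro has_vector_derivative_diff has_vector_derivative_circle[OF _ r] p q
        bounded_linear.has_vector_derivative[OF bounded_linear_cnj])
  moreover have "T (rcis r t) = p (rcis r t) - cnj (q (rcis r t))" for t
    using g_deriv(2)[OF b, of t] by (simp add: T_def p_def q_def mult_ac)
  moreover have "\<i> * (z * deriv p z) - cnj (\<i> * (z * deriv q z)) = \<i> * T' z" if "z \<in> ball 0 1" for z
    using that by (simp only: dp dq) (simp add: T'_def p_def E2_def algebra_simps)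
  ultimately show ?thesis using b[of t] by simp
qed

text \<open>This keeps \<open>f\<close> and \<open>T\<close> in the half-plane about the direction \<open>z\<close>, as \<open>arg_along\<close> requires.\<close>

lemma near_identity:
  assumes z: "z \<in> ball 0 1" "z \<noteq> 0"
  shows "cmod (f z - z) < cmod z" "cmod (T z - z) < cmod z"
proof -
  have sq: "(cmod z)\<^sup>2 \<le> cmod z" using z by (simp add: power2_eq_square mult_left_le)
  have al: "cmod \<alpha> * (cmod z)\<^sup>2 \<le> 2 / 11 * (cmod z)\<^sup>2" using alpha by (intro mult_right_mono) auto
  have "cmod (f z - z) \<le> cmod (E0 z) + cmod (g z)"
    using norm_triangle_ineq[of "E0 z" "cnj (g z)"] z by (simp add: f_eq E0_def algebra_simps)
  also have "\<dots> < cmod z"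
  proof -
    have "cmod z > 0" using z(2) by simp
    moreover have "cmod (g z) \<le> 5 / 4 * (cmod \<alpha> * (cmod z)\<^sup>2)"
      using g_bound[OF z(1)] by (simp add: mult.assoc)
    ultimately show ?thesis using E_bounds(1)[OF z(1)] al sq by linarith
  qed
  finally show "cmod (f z - z) < cmod z" .
  have "cmod z * cmod (deriv g z) \<le> cmod z * (5 / 4 * cmod \<alpha> * cmod z)"
    using g_deriv(3)[OF z(1)] by (rule mult_left_mono) simp
  then have "cmod (z * deriv g z) \<le> 5 / 4 * (cmod \<alpha> * (cmod z)\<^sup>2)"
    by (simp add: norm_mult power2_eq_square mult_ac)
  moreover have "cmod (T z - z) \<le> cmod (E1 z) + cmod (z * deriv g z)"
    using norm_triangle_ineq4[of "E1 z" "cnj (z * deriv g z)"]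
    by (simp add: T_def algebra_simps norm_mult)
  moreover have "cmod z > 0" using z(2) by simp
  ultimately show "cmod (T z - z) < cmod z" using E_bounds(2)[OF z(1)] al sq by linarith
qed

lemma pos_rotation:
  assumes "0 < r" "r < 1"
  shows "Re (f (rcis r t) * cis (- t)) > 0" "Re (T (rcis r t) * cis (- t)) > 0"
proof -
  have z: "rcis r t \<in> ball 0 1" "rcis r t \<noteq> 0" using assms by auto
  show "Re (f (rcis r t) * cis (- t)) > 0" "Re (T (rcis r t) * cis (- t)) > 0"
    by (rule Re_mult_cis_pos; use near_identity[OF z] assms in simp)+
qed

text \<open>The criterion of \<open>Re_divide_greater\<close> with \<open>N = T z\<close> and \<open>D = f z\<close>. The left side of the
  hypothesis adds up the bounds for \<open>T z - f z\<close> and for the part \<open>R\<close> of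
  \<open>T z + (1 - 2 * \<beta>) * f z\<close> beyond its main term \<open>(2 - 2 * \<beta>) * z\<close>.\<close>

lemma radius_rotation:
  assumes z: "z \<in> ball 0 1" "z \<noteq> 0" and "\<beta> < 1"
    and le: "3 / 8 + 15 / 4 * cmod \<alpha> + \<bar>1 - 2 * \<beta>\<bar> * (1 / 8 + 5 / 4 * cmod \<alpha>) \<le> 2 - 2 * \<beta>"
  shows "\<beta> < Re (T z / f z)"
proof (rule Re_divide_greater)
  let ?k = "1 - 2 * \<beta>" and ?s = "(cmod z)\<^sup>2"
  have zg: "cmod (z * deriv g z) \<le> 5 / 4 * cmod \<alpha> * ?s"
    using mult_left_mono[OF g_deriv(3)[OF z(1)], of "cmod z"]
    by (simp add: norm_mult power2_eq_square mult_ac)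
  note b = E_bounds[OF z(1)] g_bound[OF z(1)] zg
  have "T z - f z = (E1 z - E0 z) - cnj (z * deriv g z) - cnj (g z)"
    using z by (simp add: T_def f_eq E0_def)
  then have "cmod (T z - f z) \<le> cmod (E1 z - E0 z) + cmod (z * deriv g z) + cmod (g z)"
    using norm_triangle_ineq4[of "(E1 z - E0 z) - cnj (z * deriv g z)" "cnj (g z)"]
      norm_triangle_ineq4[of "E1 z - E0 z" "cnj (z * deriv g z)"]
    unfolding complex_mod_cnj by simp
  then have up: "cmod (T z - f z) \<le> (1 / 8 + 5 / 2 * cmod \<alpha>) * ?s"
    using b by (simp add: algebra_simps)
  define R where "R = E1 z - cnj (z * deriv g z) + of_real ?k * (E0 z + cnj (g z))"
  have "T z + of_real ?k * f z = of_real (2 - 2 * \<beta>) * z + R"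
    using z by (simp add: R_def T_def f_eq E0_def algebra_simps)
  moreover have "cmod (of_real (2 - 2 * \<beta>) * z) = (2 - 2 * \<beta>) * cmod z"
    using \<open>\<beta> < 1\<close> by (simp add: norm_mult del: of_real_diff)
  ultimately have lo: "cmod (T z + of_real ?k * f z) \<ge> (2 - 2 * \<beta>) * cmod z - cmod R"
    using norm_diff_ineq[of "of_real (2 - 2 * \<beta>) * z" R] by simp
  have "cmod (E0 z + cnj (g z)) \<le> (1 / 8 + 5 / 4 * cmod \<alpha>) * ?s"
    using norm_triangle_ineq[of "E0 z" "cnj (g z)"] b unfolding complex_mod_cnj
    by (simp add: algebra_simps)
  then have "\<bar>?k\<bar> * cmod (E0 z + cnj (g z)) \<le> \<bar>?k\<bar> * ((1 / 8 + 5 / 4 * cmod \<alpha>) * ?s)"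
    by (rule mult_left_mono) simp
  moreover have "cmod R \<le> cmod (E1 z) + cmod (z * deriv g z) + \<bar>?k\<bar> * cmod (E0 z + cnj (g z))"
    using norm_triangle_ineq[of "E1 z - cnj (z * deriv g z)" "of_real ?k * (E0 z + cnj (g z))"]
      norm_triangle_ineq4[of "E1 z" "cnj (z * deriv g z)"]
    unfolding R_def complex_mod_cnj norm_mult[of "of_real ?k"] norm_of_real by simp
  ultimately have R: "cmod R \<le>
      (1 / 4 + 5 / 4 * cmod \<alpha> + \<bar>?k\<bar> * (1 / 8 + 5 / 4 * cmod \<alpha>)) * ?s"
    using b by (simp add: algebra_simps)
  have "cmod (T z - f z) + cmod R \<le>
      (3 / 8 + 15 / 4 * cmod \<alpha> + \<bar>?k\<bar> * (1 / 8 + 5 / 4 * cmod \<alpha>)) * ?s"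
    using up R by (simp add: distrib_right)
  also have "\<dots> \<le> (2 - 2 * \<beta>) * ?s" using le by (rule mult_right_mono) simp
  also have "\<dots> < (2 - 2 * \<beta>) * cmod z"
    using z \<open>\<beta> < 1\<close> by (simp add: power2_eq_square)
  finally show "cmod (T z - f z) < cmod (T z + of_real ?k * f z)" using lo by simp
  show "f z \<noteq> 0" using near_identity(1)[OF z] by auto
qed fact

text \<open>The criterion of \<open>Re_divide_greater\<close> with \<open>N = T' z\<close> and \<open>D = T z\<close>. In \<open>T' z - T z\<close> and in
  \<open>R\<close> the \<open>\<alpha>\<close>-terms are gathered into one product each before they are estimated; bounding those of
  \<open>T\<close> and \<open>T'\<close> separately in \<open>T' z + (1 - 2 * \<beta>) * T z\<close> would lose a cancellation and miss
  \<open>|\<alpha>| = 2/11\<close>.\<close>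

lemma tangent_rotation:
  assumes z: "z \<in> ball 0 1" "z \<noteq> 0" and \<beta>: "0 \<le> \<beta>" "\<beta> \<le> 1 / 2"
    and le: "11 / 2 * cmod \<alpha> + 3 / 2 * \<beta> + 5 / 2 * cmod \<alpha> * \<beta> \<le> 1"
  shows "\<beta> < Re (T' z / T z)"
proof (rule Re_divide_greater)
  let ?k = "1 - 2 * \<beta>" and ?r = "cmod z" and ?a = "cmod \<alpha>"
  have r: "?r < 1" "0 < ?r" using z by auto
  have sq: "?r\<^sup>2 < ?r" using r by (simp add: power2_eq_square)
  note b = E_bounds[OF z(1)]
  have dg: "deriv g z = \<alpha> * (z + E1 z)" by (rule g_deriv(2)[OF z(1)])
  have "T' z - T z = (E2 z - E1 z) + cnj (\<alpha> * z * (3 * z + (E2 z + 2 * E1 z)))"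
    by (simp add: T'_def T_def dg algebra_simps)
  then have "cmod (T' z - T z) \<le>
      cmod (E2 z - E1 z) + ?a * ?r * cmod (3 * z + (E2 z + 2 * E1 z))"
    using norm_triangle_ineq[of "E2 z - E1 z" "cnj (\<alpha> * z * (3 * z + (E2 z + 2 * E1 z)))"]
    unfolding complex_mod_cnj norm_mult by simp
  moreover have "cmod (3 * z + (E2 z + 2 * E1 z)) \<le> 4"
    using norm_triangle_ineq[of "3 * z" "E2 z + 2 * E1 z"] b(6) sq r by (simp add: norm_mult)
  then have "?a * ?r * cmod (3 * z + (E2 z + 2 * E1 z)) \<le> ?a * ?r * 4"
    by (rule mult_left_mono) simp
  ultimately have up: "cmod (T' z - T z) < (1 / 4 + 4 * ?a) * ?r"
    using b(5) sq by (simp add: algebra_simps)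
  define Q where "Q = of_real (2 * \<beta>) * (z + E1 z) + (z + E2 z)"
  define R where "R = E2 z + of_real ?k * E1 z + cnj (\<alpha> * z * Q)"
  have "T' z + of_real ?k * T z = of_real (2 - 2 * \<beta>) * z + R"
    by (simp add: R_def Q_def T_def T'_def dg algebra_simps)
  moreover have "cmod (of_real (2 - 2 * \<beta>) * z) = (2 - 2 * \<beta>) * ?r"
    using \<beta> by (simp add: norm_mult del: of_real_diff)
  ultimately have lo: "cmod (T' z + of_real ?k * T z) \<ge> (2 - 2 * \<beta>) * ?r - cmod R"
    using norm_diff_ineq[of "of_real (2 - 2 * \<beta>) * z" R] by simp
  have "cmod (z + E1 z) \<le> 5 / 4" "cmod (z + E2 z) \<le> 3 / 2"
    using norm_triangle_ineq[of z "E1 z"] norm_triangle_ineq[of z "E2 z"] b sq r by auto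
  moreover have "cmod Q \<le> 2 * \<beta> * cmod (z + E1 z) + cmod (z + E2 z)"
    using norm_triangle_ineq[of "of_real (2 * \<beta>) * (z + E1 z)" "z + E2 z"] \<beta>
    by (simp add: Q_def norm_mult)
  ultimately have "cmod Q \<le> 2 * \<beta> * (5 / 4) + 3 / 2"
    using \<beta> mult_left_mono[of "cmod (z + E1 z)" "5 / 4" "2 * \<beta>"] by simp
  then have "?a * ?r * cmod Q \<le> ?a * ?r * (2 * \<beta> * (5 / 4) + 3 / 2)"
    by (rule mult_left_mono) simp
  moreover have "cmod R \<le> cmod (E2 z) + ?k * cmod (E1 z) + ?a * ?r * cmod Q"
    using norm_triangle_ineq[of "E2 z + of_real ?k * E1 z" "cnj (\<alpha> * z * Q)"]
      norm_triangle_ineq[of "E2 z" "of_real ?k * E1 z"] \<beta>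
    unfolding R_def complex_mod_cnj norm_mult norm_of_real by simp
  moreover have "?k * cmod (E1 z) \<le> ?k * (1 / 4 * ?r)"
    using b(2) sq \<beta> by (intro mult_left_mono) auto
  ultimately have R: "cmod R \<le> (3 / 4 - \<beta> / 2 + ?a * (3 / 2 + 5 / 2 * \<beta>)) * ?r"
    using b(3) sq by (simp add: algebra_simps)
  have "cmod (T' z - T z) + cmod R < (1 + 11 / 2 * ?a + 5 / 2 * ?a * \<beta> - \<beta> / 2) * ?r"
    using up R by (simp add: algebra_simps)
  also have "\<dots> \<le> (2 - 2 * \<beta>) * ?r" using le by (intro mult_right_mono) auto
  finally show "cmod (T' z - T z) < cmod (T' z + of_real ?k * T z)" using lo by simp
  show "T z \<noteq> 0" using near_identity(2)[OF z] by auto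
  show "\<beta> < 1" using \<beta> by simp
qed

section \<open>Convexity of the image\<close>

text \<open>The image of the open disc is open, so the frontier of the image of the closed disc is contained
  in the image of the circle. The tangent there supports the whole curve, hence the whole image.\<close>

lemma convex_image_cball:
  assumes r: "0 < r" "r < 1"
  shows "convex (f ` cball 0 r)"
proof (rule convex_if_supported)
  let ?K = "f ` cball 0 r"
  have sub: "cball 0 r \<subseteq> (ball 0 1 :: complex set)" using r by auto
  have K: "compact ?K"
    using sub f_continuous by (intro compact_continuous_image) (auto intro: continuous_on_subset)
  then show "closed ?K" by (rule compact_imp_closed)
  have int: "f ` ball 0 r \<subseteq> interior ?K"
    using r by (intro interior_maximal f_open image_mono) auto
  then show "f 0 \<in> interior ?K" using r by auto
  have bd: "\<exists>z. cmod z = r \<and> x = f z" if "x \<in> frontier ?K" for x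
  proof -
    have "x \<in> ?K" "x \<notin> interior ?K" using that \<open>closed ?K\<close> by (auto simp: frontier_def)
    then obtain z where z: "cmod z \<le> r" "x = f z" by auto
    then have "\<not> cmod z < r" using int \<open>x \<notin> interior ?K\<close> by force
    then show ?thesis using z by force
  qed
  fix x assume "x \<in> frontier ?K"
  then obtain z where z: "cmod z = r" "x = f z" using bd by blast
  define s where "s = Arg z"
  have zs: "z = rcis r s" using z(1) rcis_cmod_Arg[of z] by (simp add: s_def)
  have per: "rcis r (s + 2 * pi) = rcis r s" by (simp add: complex_eq_iff)
  have nz: "T (rcis r s) \<noteq> 0" using pos_rotation(2)[OF r, of s] by auto
  have "T (rcis r s) \<bullet> y \<le> T (rcis r s) \<bullet> f (rcis r s)" if y: "y \<in> ?K" for y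
  proof (rule inner_le_if_frontier_le[OF K nz _ y])
    fix v assume "v \<in> frontier ?K"
    then obtain w where w: "cmod w = r" "v = f w" using bd by blast
    \<comment> \<open>The angle of \<open>w\<close> in the period that starts at \<open>s\<close>.\<close>
    define t where "t = s + Arg2pi (w / cis s)"
    have "w / cis s = of_real r * cis (Arg2pi (w / cis s))"
      using Arg2pi_eq[of "w / cis s"] w(1) by (simp add: norm_divide cis_conv_exp)
    then have "w = rcis r t"
      by (simp add: t_def rcis_def field_simps flip: cis_mult)
    moreover have "s \<le> t" "t \<le> s + 2 * pi"
      using Arg2pi_ge_0 Arg2pi_lt_2pi[of "w / cis s"] by (auto simp: t_def)
    ultimately show "T (rcis r s) \<bullet> v \<le> T (rcis r s) \<bullet> f (rcis r s)"
      unfolding w(2)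
      using tangent_supports_curve[where \<gamma> = "\<lambda>t. f (rcis r t)" and T = "\<lambda>t. T (rcis r t)"
          and N = "\<lambda>t. T' (rcis r t)" and s = s and t = t]
        f_circle[of r] T_circle[of r] pos_rotation(2)[OF r] tangent_rotation[of _ 0] r alpha per
      by simp
  qed
  then show "\<exists>u. u \<noteq> 0 \<and> (\<forall>y\<in>?K. u \<bullet> y \<le> u \<bullet> x)" using nz z(2) zs by blast
qed

lemma convex_image: "convex (f ` ball 0 1)"
proof (rule convexI)
  fix x y u v assume xy: "x \<in> f ` ball 0 1" "y \<in> f ` ball 0 1"
    and uv: "(0::real) \<le> u" "0 \<le> v" "u + v = 1"
  obtain z w where zw: "x = f z" "y = f w" "cmod z < 1" "cmod w < 1" using xy by auto
  obtain r where r: "max (cmod z) (cmod w) < r" "r < 1"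
    using dense[of "max (cmod z) (cmod w)" 1] zw by auto
  then have "0 < r" using norm_ge_zero[of z] by linarith
  then have "u *\<^sub>R x + v *\<^sub>R y \<in> f ` cball 0 r"
    using convexD[OF convex_image_cball] r zw uv by auto
  then show "u *\<^sub>R x + v *\<^sub>R y \<in> f ` ball 0 1" using r by force
qed

section \<open>Criteria for full starlikeness and full convexity\<close>

lemma fully_starlike_f:
  assumes "f \<in> class_H" and \<beta>: "0 \<le> \<beta>" "\<beta> < 1"
    and "3 / 8 + 15 / 4 * cmod \<alpha> + \<bar>1 - 2 * \<beta>\<bar> * (1 / 8 + 5 / 4 * cmod \<alpha>) \<le> 2 - 2 * \<beta>"
  shows "fully_starlike \<beta> f"
proof -
  have 0: "0 \<in> f ` ball 0 1" using assms(1) by (force simp: class_H_def)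
  have "\<exists>d>\<beta>. has_arg_derivative (\<lambda>t. f (rcis r t)) d \<theta>" if r: "0 < r" "r < 1" for r \<theta>
    using has_arg_derivative_along[OF f_circle pos_rotation(1)[OF r]] r
      radius_rotation[of "rcis r \<theta>" \<beta>] assms
    by (intro exI[of _ "Re (T (rcis r \<theta>) / f (rcis r \<theta>))"]) auto
  then show ?thesis
    unfolding fully_starlike_def starlike_wrt_origin_def
    using assms f_inj f_sense_preserving f_open[of "ball 0 1"] convex_connected[OF convex_image] 0
      closed_segment_subset[OF 0 _ convex_image] by auto
qed

lemma fully_convex_f:
  assumes "f \<in> class_H" and \<beta>: "0 \<le> \<beta>" "\<beta> \<le> 1 / 2"
    and "11 / 2 * cmod \<alpha> + 3 / 2 * \<beta> + 5 / 2 * cmod \<alpha> * \<beta> \<le> 1"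
  shows "fully_convex \<beta> f"
proof -
  have "\<exists>d>\<beta>. has_arg_derivative (\<lambda>t. vector_derivative (\<lambda>s. f (rcis r s)) (at t)) d \<theta>"
    if r: "0 < r" "r < 1" for r \<theta>
  proof -
    have "vector_derivative (\<lambda>s. f (rcis r s)) (at t) = \<i> * T (rcis r t)" for t
      using f_circle[of r t] r by (intro vector_derivative_at) auto
    moreover have "has_arg_derivative (\<lambda>t. \<i> * T (rcis r t)) (Re (T' (rcis r \<theta>) / T (rcis r \<theta>))) \<theta>"
      using r pos_rotation(2)[OF r]
      by (intro has_arg_derivative_cmult_ii has_arg_derivative_along T_circle) auto
    moreover have "\<beta> < Re (T' (rcis r \<theta>) / T (rcis r \<theta>))"
      using r assms by (intro tangent_rotation) auto
    ultimately show ?thesis by auto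
  qed
  then show ?thesis
    unfolding fully_convex_def
    using assms f_inj f_sense_preserving f_open[of "ball 0 1"] convex_image
      convex_connected[OF convex_image] by auto
qed

end

section \<open>The orders of starlikeness and convexity\<close>

theorem theorem2p4:
  fixes f h g :: "complex \<Rightarrow> complex" and a b :: "nat \<Rightarrow> complex" and \<alpha> :: complex
  assumes "f \<in> class_H"
    and "\<And>z. z \<in> ball 0 1 \<Longrightarrow> f z = h z + cnj (g z)"
    and "h analytic_on ball 0 1" and "g analytic_on ball 0 1"
    and "\<And>z. z \<in> ball 0 1 \<Longrightarrow> (\<lambda>n. a (n + 2) * z ^ (n + 2)) sums (h z - z)"
    and "\<And>z. z \<in> ball 0 1 \<Longrightarrow> (\<lambda>n. b (n + 1) * z ^ (n + 1)) sums g z"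
    and "\<And>z. z \<in> ball 0 1 \<Longrightarrow> deriv g z = \<alpha> * z * deriv h z"
    and "summable (\<lambda>n. real (n + 2) ^ 3 * cmod (a (n + 2)))"
    and "(\<Sum>n. real (n + 2) ^ 3 * cmod (a (n + 2))) \<le> 1"
    and "cmod \<alpha> \<le> 2 / 11"
  shows "fully_starlike (2 * (6 - 11 * cmod \<alpha>) / (18 + 11 * cmod \<alpha>)) f
    \<and> fully_convex (2 * (2 - 11 * cmod \<alpha>) / (10 + 11 * cmod \<alpha>)) f"
proof -
  define c where "c n = (if n < 2 then 0 else a n)" for n
  have c: "c 0 = 0" "c 1 = 0" "c (n + 2) = a (n + 2)" for n by (simp_all add: c_def)
  have shift: "(\<lambda>n. F (n + 2)) sums S \<longleftrightarrow> F sums S" if "F 0 = 0" "F 1 = 0"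
    for F :: "nat \<Rightarrow> 'v::real_normed_vector" and S
    using sums_iff_shift[of F 2 S] that by (simp add: numeral_2_eq_2)
  have "(\<lambda>n. real (n + 2) ^ 3 * cmod (c (n + 2))) sums (\<Sum>n. real (n + 2) ^ 3 * cmod (a (n + 2)))"
    unfolding c(3) using assms(8) by (rule summable_sums)
  then have cs: "(\<lambda>n. real n ^ 3 * cmod (c n)) sums (\<Sum>n. real (n + 2) ^ 3 * cmod (a (n + 2)))"
    by (subst (asm) shift) (simp_all add: c_def)
  interpret cubic_shear f h g c \<alpha>
  proof
    show "h holomorphic_on ball 0 1" "g holomorphic_on ball 0 1"
      using assms(3,4) by (simp_all add: analytic_imp_holomorphic)
    show "(\<lambda>n. c n * z ^ n) sums (h z - z)" if "z \<in> ball 0 1" for z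
    proof -
      have "(\<lambda>n. c (n + 2) * z ^ (n + 2)) sums (h z - z)"
        unfolding c(3) by (rule assms(5)[OF that])
      then show ?thesis by (subst (asm) shift) (simp_all add: c_def)
    qed
    show "summable (\<lambda>n. real n ^ 3 * cmod (c n))" using cs by (rule sums_summable)
    show "(\<Sum>n. real n ^ 3 * cmod (c n)) \<le> 1" using sums_unique[OF cs] assms(9) by simp
    show "g 0 = 0" using assms(6)[of 0] sums_unique2[OF _ sums_zero] by simp
  qed (use assms c in auto)
  let ?x = "cmod \<alpha>"
  let ?\<beta> = "2 * (6 - 11 * ?x) / (18 + 11 * ?x)" and ?\<gamma> = "2 * (2 - 11 * ?x) / (10 + 11 * ?x)"
  have x: "0 \<le> ?x" "?x \<le> 2 / 11" using assms(10) by auto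
  have pos: "18 + 11 * ?x > 0" "10 + 11 * ?x > 0" using x by linarith+
  have xx: "?x * ?x \<le> 2 / 11 * ?x" using x by (intro mult_right_mono) auto
  \<comment> \<open>The order of starlikeness decreases from \<open>2/3\<close> at \<open>\<alpha> = 0\<close> to \<open>2/5\<close> at \<open>|\<alpha>| = 2/11\<close>, which
    leaves enough room to replace \<open>|1 - 2 * \<beta>|\<close> by its upper bound \<open>1/3\<close>.\<close>
  have "2 / 5 \<le> ?\<beta>" "?\<beta> \<le> 2 / 3"
    using x pos by (simp_all add: pos_le_divide_eq pos_divide_le_eq)
  moreover have "\<bar>1 - 2 * t\<bar> \<le> 1 / 3" if "2 / 5 \<le> t" "t \<le> 2 / 3" for t :: real
    using that by (simp add: abs_if)
  ultimately have "\<bar>1 - 2 * ?\<beta>\<bar> \<le> 1 / 3" by blast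
  then have "\<bar>1 - 2 * ?\<beta>\<bar> * (1 / 8 + 5 / 4 * ?x) \<le> 1 / 3 * (1 / 8 + 5 / 4 * ?x)"
    using x by (intro mult_right_mono) auto
  moreover have "3 / 8 + 15 / 4 * ?x + 1 / 3 * (1 / 8 + 5 / 4 * ?x) \<le> 2 - 2 * ?\<beta>"
    using x xx pos by (simp add: field_simps)
  ultimately have "fully_starlike ?\<beta> f"
    using \<open>2 / 5 \<le> ?\<beta>\<close> \<open>?\<beta> \<le> 2 / 3\<close> by (intro fully_starlike_f assms(1)) linarith+
  moreover have "fully_convex ?\<gamma> f"
  proof (rule fully_convex_f[OF assms(1)])
    show nonneg: "0 \<le> ?\<gamma>" and "?\<gamma> \<le> 1 / 2"
      using x pos by (simp_all add: pos_divide_le_eq)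
    have "11 / 2 * t + 3 / 2 * y + 5 / 2 * t * y \<le> 1"
      if "y * (10 + 11 * t) = 2 * (2 - 11 * t)" "0 \<le> y" "0 \<le> t" for y t :: real
    proof -
      have "0 \<le> t * y" using that by simp
      moreover have "10 * y + 11 * (t * y) + 22 * t = 4" using that(1) by (simp add: algebra_simps)
      ultimately have "11 / 2 * t + 3 / 2 * y + 5 / 2 * (t * y) \<le> 1" using that(2) by linarith
      then show ?thesis by (simp add: mult.assoc)
    qed
    moreover have "?\<gamma> * (10 + 11 * ?x) = 2 * (2 - 11 * ?x)" using pos by simp
    ultimately show "11 / 2 * ?x + 3 / 2 * ?\<gamma> + 5 / 2 * ?x * ?\<gamma> \<le> 1"
      using nonneg x(1) by blast
  qed
  ultimately show ?thesis by blast
qed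

end
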